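(* For every integer $n\ge 2$, $$\psi_{sq}(Q_n)=\beta_2(Q_n)=2^{n-1},$$ where $Q_n$ is the $n$-dimensional hypercube.
   Context: All graphs are finite, simple and undirected. $N_G[v]$ denotes the closed neighborhood of $v$ in $G$. A sub-quorum coloring of $G$ with $k$ colors is a partial map $f:V(G)\dashrightarrow\{1,\ldots,k\}$ that is onto and such that, with $S=\operatorname{dom}(f)$, every $v\in S$ satisfies $|\{u\in N_G[v]\cap S: f(u)=f(v)\}|\ge \frac12|N_G[v]\cap S|$. $\psi_{sq}(G)$ is the maximum $k$ for which a sub-quorum coloring of $G$ with $k$ colors exists. A set $S\subseteq V(G)$ is $2$-independent if the induced subgraph $G[S]$ has maximum degree at most $1$; $\beta_2(G)$ is the maximum cardinality of a $2$-independent set. $Q_n$ has vertex set $\{0,1\}^n$, two binary strings being adjacent when they differ in exactly one coordinate. *)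

theory Defs
  imports Complex_Main "Graph_Theory.Graph_Theory"
begin

text \<open>
  Finite simple undirected graphs are the finite symmetric loopless digraphs
  without parallel arcs of the locale \<^locale>\<open>pair_graph\<close>: an edge \<open>uv\<close> is
  the pair of arcs \<open>(u, v)\<close>, \<open>(v, u)\<close>, so the degree of a vertex is its out-degree.
\<close>

definition closed_nbhd :: "'a pair_pre_digraph \<Rightarrow> 'a \<Rightarrow> 'a set" where
  "closed_nbhd G v = insert v {u \<in> pverts G. v \<rightarrow>\<^bsub>with_proj G\<^esub> u}"

definition sub_quorum_coloring :: "'a pair_pre_digraph \<Rightarrow> nat \<Rightarrow> ('a \<rightharpoonup> nat) \<Rightarrow> bool" where
  "sub_quorum_coloring G k f \<longleftrightarrow>
     dom f \<subseteq> pverts G \<and> ran f = {1..k} \<and>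
     (\<forall>v \<in> dom f.
        real (card {u \<in> closed_nbhd G v \<inter> dom f. f u = f v})
          \<ge> 1 / 2 * real (card (closed_nbhd G v \<inter> dom f)))"

definition psi_sq :: "'a pair_pre_digraph \<Rightarrow> nat" where
  "psi_sq G = Max {k. \<exists>f. sub_quorum_coloring G k f}"

definition two_independent :: "'a pair_pre_digraph \<Rightarrow> 'a set \<Rightarrow> bool" where
  "two_independent G S \<longleftrightarrow>
     S \<subseteq> pverts G \<and> (\<forall>v \<in> S. out_degree (with_proj G \<restriction> S) v \<le> 1)"

definition beta_2 :: "'a pair_pre_digraph \<Rightarrow> nat" where
  "beta_2 G = Max (card ` {S. two_independent G S})"

text \<open>Binary strings of length \<open>n\<close> are Boolean lists, \<open>False\<close> standing for 0 and \<open>True\<close> for 1.\<close>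

definition hypercube :: "nat \<Rightarrow> bool list pair_pre_digraph" where
  "hypercube n =
     \<lparr> pverts = {x. length x = n},
       parcs = {(x, y). length x = n \<and> length y = n \<and> card {i. i < n \<and> x ! i \<noteq> y ! i} = 1} \<rparr>"

lemma pair_graph_hypercube: "pair_graph (hypercube n)"
proof -
  have fin: "finite {x :: bool list. length x = n}"
    using finite_lists_length_eq[of "UNIV :: bool set" n] by simp
  have "parcs (hypercube n) \<subseteq> {x. length x = n} \<times> {x. length x = n}"
    by (auto simp: hypercube_def)
  then have fin': "finite (parcs (hypercube n))"
    by (rule finite_subset) (simp add: fin)
  have wf: "fst e \<in> pverts (hypercube n) \<and> snd e \<in> pverts (hypercube n) \<and> fst e \<noteq> snd e"
    if "e \<in> parcs (hypercube n)" for e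
    using that by (cases e) (auto simp: hypercube_def)
  have "(y, x) \<in> parcs (hypercube n)" if "(x, y) \<in> parcs (hypercube n)" for x y
  proof -
    have "{i. i < n \<and> y ! i \<noteq> x ! i} = {i. i < n \<and> x ! i \<noteq> y ! i}"
      by blast
    with that show ?thesis
      unfolding hypercube_def by simp
  qed
  then have "symmetric (with_proj (hypercube n))"
    unfolding symmetric_def with_proj_simps by (rule symI)
  moreover have "finite (pverts (hypercube n))"
    using fin by (simp add: hypercube_def)
  ultimately show ?thesis
    using wf fin' by unfold_locales blast+
qed

text \<open>The following facts show that the two maxima are attained on every finite graph.\<close>

lemma finite_sub_quorum_sizes:
  assumes "finite (pverts G)"
  shows "finite {k. \<exists>f. sub_quorum_coloring G k f}"
proof (rule finite_subset)
  show "{k. \<exists>f. sub_quorum_coloring G k f} \<subseteq> {..card (pverts G)}"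
  proof clarify
    fix k f assume f: "sub_quorum_coloring G k f"
    then have sub: "dom f \<subseteq> pverts G" and ran: "ran f = {1..k}"
      by (auto simp: sub_quorum_coloring_def)
    have "Some ` {1..k} \<subseteq> f ` dom f"
      unfolding ran[symmetric] by (auto simp: ran_def image_iff) (metis domI)
    then have "card (Some ` {1..k}) \<le> card (dom f)"
      using finite_subset[OF sub assms] by (meson surj_card_le)
    then have "k \<le> card (dom f)"
      by (simp add: card_image)
    then show "k \<le> card (pverts G)"
      using card_mono[OF assms sub] by simp
  qed
qed simp

lemma sub_quorum_sizes_nonempty: "{k. \<exists>f. sub_quorum_coloring G k f} \<noteq> {}"
proof -
  have "sub_quorum_coloring G 0 Map.empty"
    by (simp add: sub_quorum_coloring_def)
  then show ?thesis by blast
qed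

lemma finite_two_independent:
  assumes "finite (pverts G)"
  shows "finite {S. two_independent G S}"
  by (rule finite_subset[of _ "Pow (pverts G)"]) (auto simp: two_independent_def assms)

lemma two_independent_empty: "two_independent G {}"
  by (simp add: two_independent_def)

end

theory Submission
  imports Defs
begin

text \<open>
  Two of the three inequalities are general or elementary. Giving pairwise different colors to the
  vertices of a 2-independent set is a sub-quorum coloring, since each vertex then sees at most one
  colored neighbor besides itself; so \<^term>\<open>beta_2 G \<le> psi_sq G\<close> on every finite graph. The
  strings of even weight are independent and make up half of the cube.

  The remaining inequality, that \<open>k\<close> colors need \<open>k \<le> 2 ^ (n - 1)\<close>, says that the average number of
  colors per 4-cycle is at most 2, once every color is spread evenly: a colored vertex \<open>x\<close> whose color
  class has \<open>m\<close> elements gets weight \<open>w x = 1 / m\<close>, and an uncolored one gets weight 0. The weights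
  sum to \<open>k\<close>, and every vertex is in equally many 4-cycles. A single 4-cycle can have total weight above
  2, but only in one way: opposite corners \<open>a\<close> and \<open>c\<close> form color classes of their own, which gives
  them at most one colored neighbor each, and this is a common neighbor \<open>b\<close>, whose class is larger;
  the excess is then \<open>w b\<close>. In the other direction, a 4-cycle with two opposite uncolored corners
  misses the value 2 by at least the sum of \<open>1 - w x\<close> over its colored corners \<open>x\<close>. The corner
  charges collect these amounts at \<open>b\<close> and at \<open>x\<close> (\<open>square_sum_le_corner_charges\<close>), and the sum of all charges has to
  be shown to be at most 0.

  This is done by moving charges inside each color class. Suppose that \<open>x\<close> has \<open>s \<ge> 2\<close> neighbors that
  are alone in their class, and so \<open>s * (s - 1)\<close> ordered pairs of them. The quorum condition gives
  \<open>x\<close> at least \<open>s - 1\<close> neighbors \<open>y\<close> in its own class. If \<open>a\<close> is one of the \<open>s\<close> lonely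
  neighbors, then the fourth vertex of the 4-cycle through \<open>a\<close>, \<open>x\<close> and \<open>y\<close> is uncolored, because
  \<open>a\<close> already has the colored neighbor \<open>x\<close>. So \<open>y\<close> has \<open>u \<ge> s\<close> uncolored neighbors, and
  \<open>u * (u - 1) \<ge> s\<close>. Thus the excess at \<open>x\<close> is covered by its class neighbors when each \<open>y\<close> pays
  \<open>w x * u * (u - 1)\<close> to each of its class neighbors \<open>x\<close>; there are at most \<open>m - 1\<close> of them, so
  \<open>y\<close> pays at most \<open>(m - 1) / m = 1 - w y\<close> times \<open>u * (u - 1)\<close>, which is the deficit at \<open>y\<close>
  (\<open>sum_lonely_le_sum_uncolored\<close>).
\<close>

section \<open>From 2-independent sets to sub-quorum colorings\<close>

lemma card_out_nbrs_eq_out_degree: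
  assumes "v \<in> S"
  shows "card {u \<in> S. v \<rightarrow>\<^bsub>with_proj G\<^esub> u} = out_degree (with_proj G \<restriction> S) v"
proof -
  have "out_arcs (with_proj G \<restriction> S) v = Pair v ` {u \<in> S. v \<rightarrow>\<^bsub>with_proj G\<^esub> u}"
    using assms by (auto simp: out_arcs_def induce_subgraph_def)
  then show ?thesis
    by (simp add: out_degree_def card_image inj_on_def)
qed

lemma card_le_psi_sq_if_two_independent:
  assumes fin: "finite (pverts G)" and S: "two_independent G S"
  shows "card S \<le> psi_sq G"
proof -
  have sub: "S \<subseteq> pverts G" and deg: "\<And>v. v \<in> S \<Longrightarrow> out_degree (with_proj G \<restriction> S) v \<le> 1"
    using S by (auto simp: two_independent_def)
  have finS: "finite S"
    using finite_subset[OF sub fin] .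
  obtain h where "bij_betw h S {0..<card S}"
    using ex_bij_betw_finite_nat[OF finS] by blast
  then have inj: "inj_on h S" and im: "h ` S = {0..<card S}"
    by (auto simp: bij_betw_def)
  define f where "f = (\<lambda>v. if v \<in> S then Some (Suc (h v)) else None)"
  have dom: "dom f = S"
    by (auto simp: f_def split: if_splits)
  have "ran f = Suc ` h ` S"
    by (auto simp: ran_def f_def image_iff split: if_splits)
  also have "\<dots> = {1..card S}"
    by (auto simp: im image_Suc_atLeastLessThan)
  finally have ran: "ran f = {1..card S}" .
  have "real (card {u \<in> closed_nbhd G v \<inter> dom f. f u = f v})
          \<ge> 1 / 2 * real (card (closed_nbhd G v \<inter> dom f))" if "v \<in> dom f" for v
  proof -
    have v: "v \<in> S" using that dom by simp
    have "{u \<in> closed_nbhd G v \<inter> dom f. f u = f v} = {v}"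
      using v inj by (auto simp: dom closed_nbhd_def f_def inj_on_def)
    moreover have "closed_nbhd G v \<inter> dom f = insert v {u \<in> S. v \<rightarrow>\<^bsub>with_proj G\<^esub> u}"
      using v sub by (auto simp: dom closed_nbhd_def)
    moreover have "card (insert v {u \<in> S. v \<rightarrow>\<^bsub>with_proj G\<^esub> u}) \<le> Suc 1"
      using deg[OF v] finS unfolding card_out_nbrs_eq_out_degree[OF v, symmetric]
      by (simp add: card_insert_if)
    ultimately show ?thesis by simp
  qed
  then have "sub_quorum_coloring G (card S) f"
    using dom ran sub by (simp add: sub_quorum_coloring_def)
  then show ?thesis
    unfolding psi_sq_def using finite_sub_quorum_sizes[OF fin] by (intro Max_ge) auto
qed

section \<open>Coordinate flips on the hypercube\<close>

definition flip :: "nat \<Rightarrow> bool list \<Rightarrow> bool list" where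
  "flip i x = x[i := \<not> x ! i]"

lemma length_flip [simp]: "length (flip i x) = length x"
  by (simp add: flip_def)

lemma flip_flip [simp]: "flip i (flip i x) = x"
  by (cases "i < length x") (simp_all add: flip_def list_update_beyond)

lemma flip_commute: "flip i (flip j x) = flip j (flip i x)"
  by (cases "i = j") (simp_all add: flip_def list_update_swap)

lemma flip_eq_flip_iff:
  assumes "i < length x" "j < length x"
  shows "flip i x = flip j x \<longleftrightarrow> i = j"
proof
  assume "flip i x = flip j x"
  then have "flip i x ! i = flip j x ! i" by simp
  then show "i = j" using assms by (cases "i = j") (simp_all add: flip_def)
qed simp

lemma flip_neq: "i < length x \<Longrightarrow> flip i x \<noteq> x"
  by (metis flip_def nth_list_update_eq)

lemma bij_betw_flip: "bij_betw (flip i) {x. length x = n} {x. length x = n}"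
  by (rule bij_betw_byWitness[where f' = "flip i"]) auto

lemma finite_cube: "finite {x :: bool list. length x = n}"
  using finite_lists_length_eq[of "UNIV :: bool set" n] by simp

lemma card_cube: "card {x :: bool list. length x = n} = 2 ^ n"
  using card_lists_length_eq[of "UNIV :: bool set" n] by simp

lemma pverts_hypercube: "pverts (hypercube n) = {x. length x = n}"
  by (simp add: hypercube_def)

lemma hypercube_adjacent_iff:
  assumes "length x = n"
  shows "(x, y) \<in> parcs (hypercube n) \<longleftrightarrow> (\<exists>i<n. y = flip i x)"
proof -
  have arc: "(x, y) \<in> parcs (hypercube n) \<longleftrightarrow>
      length y = n \<and> card {i. i < n \<and> x ! i \<noteq> y ! i} = 1"
    using assms by (simp add: hypercube_def)
  show ?thesis
  proof
    assume "(x, y) \<in> parcs (hypercube n)"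
    then obtain i where len: "length y = n" and i: "{i. i < n \<and> x ! i \<noteq> y ! i} = {i}"
      using arc by (auto simp: card_1_singleton_iff)
    have "y = flip i x"
    proof (rule nth_equalityI)
      show "length y = length (flip i x)" using len assms by simp
      fix j assume "j < length y"
      then show "y ! j = flip i x ! j"
        using i len assms by (cases "j = i") (auto simp: flip_def)
    qed
    then show "\<exists>i<n. y = flip i x" using i by auto
  next
    assume "\<exists>i<n. y = flip i x"
    then obtain i where "i < n" "y = flip i x" by blast
    moreover from this have "{j. j < n \<and> x ! j \<noteq> y ! j} = {i}"
      using assms by (auto simp: flip_def nth_list_update)
    ultimately show "(x, y) \<in> parcs (hypercube n)"
      using arc assms by simp
  qed
qed

lemma card_closed_nbhd_hypercube:
  assumes "length v = n" "v \<in> A"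
  shows "card (closed_nbhd (hypercube n) v \<inter> A) = Suc (card {i. i < n \<and> flip i v \<in> A})"
proof -
  have "closed_nbhd (hypercube n) v \<inter> A = insert v ((\<lambda>i. flip i v) ` {i. i < n \<and> flip i v \<in> A})"
    using assms by (auto simp: closed_nbhd_def hypercube_adjacent_iff pverts_hypercube)
  moreover have "v \<notin> (\<lambda>i. flip i v) ` {i. i < n \<and> flip i v \<in> A}"
    using assms flip_neq by fastforce
  moreover have "inj_on (\<lambda>i. flip i v) {i. i < n \<and> flip i v \<in> A}"
    using assms by (auto simp: inj_on_def flip_eq_flip_iff)
  ultimately show ?thesis by (simp add: card_image)
qed

section \<open>The vertices of even weight\<close>

lemma even_weight_flip:
  assumes "length x = n" "i < n"
  shows "even (card {j. j < n \<and> flip i x ! j}) \<longleftrightarrow> odd (card {j. j < n \<and> x ! j})"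
proof -
  have off: "{j. j < n \<and> flip i y ! j} = insert i {j. j < n \<and> y ! j}" "i \<notin> {j. j < n \<and> y ! j}"
    if "length y = n" "\<not> y ! i" for y
    using that assms by (auto simp: flip_def nth_list_update)
  show ?thesis
  proof (cases "x ! i")
    case True
    then have "\<not> flip i x ! i" using assms by (simp add: flip_def)
    from off[OF _ this] assms show ?thesis by simp
  next
    case False
    from off[OF assms(1) this] show ?thesis by simp
  qed
qed

lemma two_independent_even_weight:
  "two_independent (hypercube n) {x. length x = n \<and> even (card {j. j < n \<and> x ! j})}"
  (is "two_independent _ ?E")
proof -
  have "out_degree (with_proj (hypercube n) \<restriction> ?E) v = 0" if v: "v \<in> ?E" for v
  proof -
    have "{u \<in> ?E. v \<rightarrow>\<^bsub>with_proj (hypercube n)\<^esub> u} = {}"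
      using v by (auto simp: hypercube_adjacent_iff even_weight_flip)
    then show ?thesis
      using card_out_nbrs_eq_out_degree[OF v, of "hypercube n"] by (metis card.empty)
  qed
  then show ?thesis
    by (auto simp: two_independent_def pverts_hypercube)
qed

lemma card_even_weight:
  assumes "n \<ge> 1"
  shows "card {x. length x = n \<and> even (card {j. j < n \<and> x ! j})} = 2 ^ (n - 1)"
    (is "card ?E = _")
proof -
  let ?O = "{x. length x = n \<and> odd (card {j. j < n \<and> x ! j})}"
  have "bij_betw (flip 0) ?E ?O"
    by (rule bij_betw_byWitness[where f' = "flip 0"]) (use assms in \<open>auto simp: even_weight_flip Suc_le_eq\<close>)
  then have "card ?O = card ?E"
    by (simp add: bij_betw_same_card)
  moreover have "card (?E \<union> ?O) = card ?E + card ?O"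
    by (intro card_Un_disjoint finite_subset[OF _ finite_cube[of n]]) auto
  moreover have "?E \<union> ?O = {x. length x = n}"
    by auto
  ultimately have "2 * card ?E = 2 ^ n"
    by (simp add: card_cube)
  then show ?thesis
    using assms by (cases n) auto
qed

section \<open>Sub-quorum colorings of the hypercube have few colors\<close>

lemma card_off_diagonal:
  assumes "finite A"
  shows "card {(i, j). i \<in> A \<and> j \<in> A \<and> i \<noteq> j} = card A * (card A - 1)"
proof -
  have "{(i, j). i \<in> A \<and> j \<in> A \<and> i \<noteq> j} = (SIGMA i:A. A - {i})"
    by auto
  then show ?thesis
    using assms by simp
qed

lemma sum_inverse_card_fibres:
  assumes "finite A"
  shows "(\<Sum>x\<in>A. 1 / real (card {y \<in> A. g y = g x})) = real (card (g ` A))"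
proof -
  have "(\<Sum>x\<in>A. 1 / real (card {y \<in> A. g y = g x}))
      = (\<Sum>c\<in>g ` A. \<Sum>x\<in>{x \<in> A. g x = c}. 1 / real (card {y \<in> A. g y = g x}))"
    by (rule sum.image_gen[OF assms])
  also have "\<dots> = (\<Sum>c\<in>g ` A. 1)"
  proof (rule sum.cong[OF refl])
    fix c assume c: "c \<in> g ` A"
    have "(\<Sum>x\<in>{x \<in> A. g x = c}. 1 / real (card {y \<in> A. g y = g x}))
        = (\<Sum>x\<in>{x \<in> A. g x = c}. 1 / real (card {y \<in> A. g y = c}))"
      by (rule sum.cong) auto
    moreover have "card {y \<in> A. g y = c} \<noteq> 0"
      using c assms by auto
    ultimately show "(\<Sum>x\<in>{x \<in> A. g x = c}. 1 / real (card {y \<in> A. g y = g x})) = 1"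
      by simp
  qed
  finally show ?thesis by simp
qed

text \<open>
  The charge of a corner of weight \<open>p\<close>, whose neighbors in the square have weights \<open>q\<close> and \<open>r\<close>: a
  colored corner is charged its weight as excess when both neighbors are alone in their color class,
  and is credited \<open>1 - p\<close> as deficit when both are uncolored.
\<close>

definition corner_charge :: "real \<Rightarrow> real \<Rightarrow> real \<Rightarrow> real" where
  "corner_charge p q r =
     (if p \<noteq> 0 then p * of_bool (q = 1 \<and> r = 1) - (1 - p) * of_bool (q = 0 \<and> r = 0) else 0)"

text \<open>
  The corners \<open>p\<close> and \<open>t\<close> are opposite. The last four hypotheses hold because a vertex alone in its color
  class has at most one colored neighbor. The possible values leave no weight strictly between \<open>1/2\<close>
  and 1, so a sum above 2 needs a corner of weight 1, and then only the two configurations that are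
  charged matter.
\<close>

lemma square_sum_le_corner_charges:
  fixes p q r t :: real
  assumes "p = 0 \<or> p = 1 \<or> 0 < p \<and> p \<le> 1 / 2" "q = 0 \<or> q = 1 \<or> 0 < q \<and> q \<le> 1 / 2"
    and "r = 0 \<or> r = 1 \<or> 0 < r \<and> r \<le> 1 / 2" "t = 0 \<or> t = 1 \<or> 0 < t \<and> t \<le> 1 / 2"
    and "p = 1 \<Longrightarrow> q = 0 \<or> r = 0" "q = 1 \<Longrightarrow> p = 0 \<or> t = 0"
    and "r = 1 \<Longrightarrow> t = 0 \<or> p = 0" "t = 1 \<Longrightarrow> r = 0 \<or> q = 0"
  shows "p + q + r + t - 2
    \<le> corner_charge p q r + corner_charge q p t + corner_charge r t p + corner_charge t r q"
  using assms(1-4)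
  by (elim disjE) (use assms(5-8) in \<open>simp_all add: corner_charge_def\<close>)

locale colored_hypercube =
  fixes n k :: nat and f :: "bool list \<rightharpoonup> nat"
  assumes coloring: "sub_quorum_coloring (hypercube n) k f"
begin

abbreviation V where "V \<equiv> {x :: bool list. length x = n}"

abbreviation S where "S \<equiv> dom f"

definition cls :: "bool list \<Rightarrow> bool list set" where
  "cls x = {y \<in> S. f y = f x}"

definition weight :: "bool list \<Rightarrow> real" where
  "weight x = (if x \<in> S then 1 / real (card (cls x)) else 0)"

text \<open>
  Neighbors are recorded by the directions that lead to them, so that the neighborhoods of different
  vertices can be compared as sets of numbers.
\<close>

definition inner :: "bool list \<Rightarrow> nat set" where
  "inner x = {i. i < n \<and> flip i x \<in> cls x}"

definition lonely :: "bool list \<Rightarrow> nat set" where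
  "lonely x = {i. i < n \<and> weight (flip i x) = 1}"

definition uncolored :: "bool list \<Rightarrow> nat set" where
  "uncolored x = {i. i < n \<and> flip i x \<notin> S}"

abbreviation charge :: "bool list \<Rightarrow> nat \<Rightarrow> nat \<Rightarrow> real" where
  "charge x i j \<equiv> corner_charge (weight x) (weight (flip i x)) (weight (flip j x))"

lemma S_subset: "S \<subseteq> V"
  using coloring by (auto simp: sub_quorum_coloring_def hypercube_def)

lemma length_S: "x \<in> S \<Longrightarrow> length x = n"
  using S_subset by blast

lemma finite_S: "finite S"
  using finite_subset[OF S_subset finite_cube] .

lemma finite_cls [simp]: "finite (cls x)"
  using finite_S by (simp add: cls_def)

lemma self_in_cls: "x \<in> S \<Longrightarrow> x \<in> cls x"
  by (simp add: cls_def)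

lemma cls_eq: "y \<in> cls x \<Longrightarrow> cls y = cls x"
  by (auto simp: cls_def)

lemma card_cls_pos: "x \<in> S \<Longrightarrow> card (cls x) > 0"
  using self_in_cls by (auto simp: card_gt_0_iff)

lemma finite_directions [simp]: "finite (inner x)" "finite (lonely x)" "finite (uncolored x)"
  by (simp_all add: inner_def lonely_def uncolored_def)

lemma weight_eq_0_iff: "weight x = 0 \<longleftrightarrow> x \<notin> S"
  using self_in_cls[of x] by (auto simp: weight_def)

lemma weight_values: "weight x = 0 \<or> weight x = 1 \<or> 0 < weight x \<and> weight x \<le> 1 / 2"
proof (cases "x \<in> S")
  case True
  then have "card (cls x) = 1 \<or> card (cls x) \<ge> 2"
    using card_cls_pos[OF True] by linarith
  then show ?thesis
    using True by (auto simp: weight_def field_simps)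
qed (simp add: weight_def)

lemma weight_eq_1D:
  assumes "weight x = 1"
  shows "x \<in> S" "cls x = {x}"
proof -
  show x: "x \<in> S"
    using assms by (auto simp: weight_def split: if_splits)
  then have "card (cls x) = 1"
    using assms card_cls_pos by (simp add: weight_def)
  then show "cls x = {x}"
    using self_in_cls[OF x] by (metis card_1_singletonE singletonD)
qed

lemma lonely_not_in_cls:
  assumes "x \<in> S" "i \<in> lonely x"
  shows "flip i x \<notin> cls x"
proof
  assume "flip i x \<in> cls x"
  then have "cls x = {flip i x}"
    using cls_eq[of "flip i x" x] weight_eq_1D(2)[of "flip i x"] assms(2) by (simp add: lonely_def)
  then have "flip i x = x"
    using self_in_cls[OF assms(1)] by auto
  then show False
    using assms(2) flip_neq[of i x] length_S[OF assms(1)] by (simp add: lonely_def)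
qed

lemma card_colored_directions:
  assumes "x \<in> S"
  shows "card {i. i < n \<and> flip i x \<in> S} \<le> 2 * card (inner x) + 1"
proof -
  have len: "length x = n" using length_S[OF assms] .
  have "{u \<in> closed_nbhd (hypercube n) x \<inter> S. f u = f x} = closed_nbhd (hypercube n) x \<inter> cls x"
    by (auto simp: cls_def)
  moreover have "real (card {u \<in> closed_nbhd (hypercube n) x \<inter> S. f u = f x})
      \<ge> 1 / 2 * real (card (closed_nbhd (hypercube n) x \<inter> S))"
    using coloring assms by (simp add: sub_quorum_coloring_def)
  ultimately show ?thesis
    using card_closed_nbhd_hypercube[OF len assms]
      card_closed_nbhd_hypercube[OF len self_in_cls[OF assms]]
    by (simp add: inner_def)
qed

text \<open>
  Neighbors that are alone in their class lie outside the class of \<open>x\<close>, and the quorum condition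
  bounds the number of colored neighbors outside that class by one more than the number inside.
\<close>

lemma card_lonely_le:
  assumes "x \<in> S"
  shows "card (lonely x) \<le> card (inner x) + 1"
proof -
  have "lonely x \<inter> inner x = {}"
    using lonely_not_in_cls[OF assms] by (auto simp: inner_def)
  then have "card (lonely x) + card (inner x) = card (lonely x \<union> inner x)"
    by (simp add: card_Un_disjoint)
  also have "\<dots> \<le> card {i. i < n \<and> flip i x \<in> S}"
    by (rule card_mono) (auto simp: lonely_def inner_def cls_def dest: weight_eq_1D(1))
  finally show ?thesis
    using card_colored_directions[OF assms] by linarith
qed

lemma singleton_unique_colored_nbr:
  assumes "weight x = 1" "i < n" "j < n" "flip i x \<in> S" "flip j x \<in> S"
  shows "i = j"
proof -
  note x = weight_eq_1D[OF assms(1)]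
  have "inner x = {}"
    by (simp add: inner_def x(2) length_S[OF x(1)] flip_neq)
  then have "card {i. i < n \<and> flip i x \<in> S} \<le> Suc 0"
    using card_colored_directions[OF x(1)] by simp
  then show ?thesis
    using assms by (simp add: card_le_Suc0_iff_eq)
qed

lemma card_inner_less:
  assumes "x \<in> S"
  shows "card (inner x) \<le> card (cls x) - 1"
proof -
  have len: "length x = n" using length_S[OF assms] .
  have "card (inner x) = card ((\<lambda>i. flip i x) ` inner x)"
    by (rule card_image[symmetric]) (auto simp: inj_on_def inner_def len flip_eq_flip_iff)
  also have "\<dots> \<le> card (cls x - {x})"
    by (rule card_mono) (auto simp: inner_def len flip_neq)
  finally show ?thesis
    using self_in_cls[OF assms] by simp
qed

text \<open>
  If \<open>flip i x\<close> is alone in its class, then \<open>x\<close> is its only colored neighbor, so \<open>flip i (flip e x)\<close>,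
  which is another of its neighbors, is uncolored.
\<close>

lemma lonely_subset_uncolored:
  assumes x: "x \<in> S" and e: "e \<in> inner x"
  shows "lonely x \<subseteq> uncolored (flip e x)"
proof
  fix i assume i: "i \<in> lonely x"
  have "i \<noteq> e"
    using lonely_not_in_cls[OF x i] e by (auto simp: inner_def)
  moreover have "flip i (flip i x) \<in> S" using x by simp
  moreover have "flip e (flip i x) = flip i (flip e x)"
    by (rule flip_commute)
  ultimately have "flip i (flip e x) \<notin> S"
    using singleton_unique_colored_nbr[of "flip i x" i e] i e
    by (auto simp: lonely_def inner_def)
  then show "i \<in> uncolored (flip e x)"
    using i by (simp add: lonely_def uncolored_def)
qed

lemma square_bound:
  assumes "i < n" "j < n" "i \<noteq> j"
  shows "weight x + weight (flip i x) + weight (flip j x) + weight (flip i (flip j x)) - 2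
    \<le> charge x i j + charge (flip i x) i j + charge (flip j x) i j + charge (flip i (flip j x)) i j"
proof -
  let ?a = x and ?b = "flip i x" and ?c = "flip j x" and ?d = "flip i (flip j x)"
  have eqs: "flip j ?b = ?d" "flip i ?d = ?c" "flip j ?d = ?b" "flip i ?b = ?a" "flip j ?c = ?a"
    by (simp_all add: flip_commute[of j])
  have uniq: "weight y = 1 \<Longrightarrow> weight (flip i y) = 0 \<or> weight (flip j y) = 0" for y
    unfolding weight_eq_0_iff using singleton_unique_colored_nbr[of y i j] assms by blast
  show ?thesis
    unfolding eqs
    by (rule square_sum_le_corner_charges[OF weight_values weight_values weight_values weight_values])
      (use uniq[of ?a] uniq[of ?b] uniq[of ?c] uniq[of ?d] in \<open>simp_all only: eqs\<close>)
qed

lemma sum_charge_at: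
  assumes "x \<in> S"
  shows "(\<Sum>(i, j) \<in> {(i, j). i < n \<and> j < n \<and> i \<noteq> j}. charge x i j)
    = weight x * real (card (lonely x) * (card (lonely x) - 1))
      - (1 - weight x) * real (card (uncolored x) * (card (uncolored x) - 1))"
proof -
  let ?P = "{(i, j). i < n \<and> j < n \<and> i \<noteq> j}"
  have fin: "finite ?P"
    by (rule finite_subset[of _ "{..<n} \<times> {..<n}"]) auto
  have count: "(\<Sum>p\<in>?P. of_bool (Q (fst p) \<and> Q (snd p)) :: real)
      = real (card {i. i < n \<and> Q i} * (card {i. i < n \<and> Q i} - 1))" for Q
  proof -
    have "(\<Sum>p\<in>?P. of_bool (Q (fst p) \<and> Q (snd p)) :: real)
        = real (card {p \<in> ?P. Q (fst p) \<and> Q (snd p)})"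
      using fin by (simp add: of_bool_def sum.If_cases Int_def)
    also have "{p \<in> ?P. Q (fst p) \<and> Q (snd p)}
        = {(i, j). i \<in> {i. i < n \<and> Q i} \<and> j \<in> {i. i < n \<and> Q i} \<and> i \<noteq> j}"
      by auto
    also have "card \<dots> = card {i. i < n \<and> Q i} * (card {i. i < n \<and> Q i} - 1)"
      by (rule card_off_diagonal) simp
    finally show ?thesis .
  qed
  have "(\<Sum>(i, j)\<in>?P. charge x i j)
      = (\<Sum>p\<in>?P. weight x * of_bool (weight (flip (fst p) x) = 1 \<and> weight (flip (snd p) x) = 1)
          - (1 - weight x) * of_bool (flip (fst p) x \<notin> S \<and> flip (snd p) x \<notin> S))"
    unfolding corner_charge_def weight_eq_0_iff case_prod_unfold not_not if_P[OF assms] ..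
  also have "\<dots> = weight x * (\<Sum>p\<in>?P. of_bool (weight (flip (fst p) x) = 1 \<and> weight (flip (snd p) x) = 1))
          - (1 - weight x) * (\<Sum>p\<in>?P. of_bool (flip (fst p) x \<notin> S \<and> flip (snd p) x \<notin> S))"
    by (simp only: sum_subtractf sum_distrib_left)
  finally show ?thesis
    by (simp only: count[of "\<lambda>i. weight (flip i x) = 1"] count[of "\<lambda>i. flip i x \<notin> S"]
        lonely_def uncolored_def)
qed

text \<open>
  With \<open>s\<close> lonely directions there are at least \<open>s - 1\<close> summands, and for \<open>s \<ge> 2\<close> each of them is at
  least \<open>s\<close>.
\<close>

lemma lonely_pairs_le:
  assumes "x \<in> S"
  shows "card (lonely x) * (card (lonely x) - 1)
    \<le> (\<Sum>e\<in>inner x. card (uncolored (flip e x)) * (card (uncolored (flip e x)) - 1))"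
proof (cases "card (lonely x) \<ge> 2")
  case True
  have "card (lonely x) * (card (lonely x) - 1) \<le> card (lonely x) * card (inner x)"
    using card_lonely_le[OF assms] by (intro mult_le_mono2) linarith
  also have "\<dots> = (\<Sum>e\<in>inner x. card (lonely x))"
    by simp
  also have "\<dots> \<le> (\<Sum>e\<in>inner x. card (uncolored (flip e x)) * (card (uncolored (flip e x)) - 1))"
  proof (rule sum_mono)
    fix e assume "e \<in> inner x"
    then have "card (lonely x) \<le> card (uncolored (flip e x))"
      by (intro card_mono lonely_subset_uncolored assms) simp
    moreover from this True have "card (uncolored (flip e x)) - 1 \<ge> 1" by linarith
    ultimately show "card (lonely x) \<le> card (uncolored (flip e x)) * (card (uncolored (flip e x)) - 1)"
      by (metis mult.right_neutral mult_le_mono)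
  qed
  finally show ?thesis .
next
  case False
  then have "card (lonely x) = 0 \<or> card (lonely x) = 1" by linarith
  then show ?thesis by auto
qed

text \<open>
  Both sides of the bound above are weighted and summed; exchanging the endpoints of the edges inside
  color classes, where the weight is constant, turns the right-hand side into a sum over the paying
  vertices.
\<close>

lemma sum_lonely_le_sum_uncolored:
  "(\<Sum>x\<in>S. weight x * real (card (lonely x) * (card (lonely x) - 1)))
    \<le> (\<Sum>x\<in>S. (1 - weight x) * real (card (uncolored x) * (card (uncolored x) - 1)))"
proof -
  let ?U = "\<lambda>x. real (card (uncolored x) * (card (uncolored x) - 1))"
  have "(\<Sum>x\<in>S. weight x * real (card (lonely x) * (card (lonely x) - 1)))
      \<le> (\<Sum>x\<in>S. weight x * (\<Sum>e\<in>inner x. ?U (flip e x)))"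
  proof (intro sum_mono mult_left_mono)
    fix x assume "x \<in> S"
    from lonely_pairs_le[OF this] have
      "real (card (lonely x) * (card (lonely x) - 1))
        \<le> real (\<Sum>e\<in>inner x. card (uncolored (flip e x)) * (card (uncolored (flip e x)) - 1))"
      by (simp only: of_nat_le_iff)
    then show "real (card (lonely x) * (card (lonely x) - 1)) \<le> (\<Sum>e\<in>inner x. ?U (flip e x))"
      by (simp only: of_nat_sum)
  qed (simp add: weight_def)
  also have "\<dots> = (\<Sum>(x, e)\<in>Sigma S inner. weight x * ?U (flip e x))"
    by (simp only: sum_distrib_left) (rule sum.Sigma; simp add: finite_S)
  also have "\<dots> = (\<Sum>(x, e)\<in>Sigma S inner. weight x * ?U x)"
  proof (rule sum.reindex_bij_witness[where i = "\<lambda>(x, e). (flip e x, e)" and j = "\<lambda>(x, e). (flip e x, e)"])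
    fix p assume p: "p \<in> Sigma S inner"
    obtain x e where [simp]: "p = (x, e)" by (cases p)
    have x: "x \<in> S" and e: "e < n" "flip e x \<in> cls x"
      using p by (simp_all add: inner_def)
    have "flip e x \<in> S" using e by (simp add: cls_def)
    moreover have "cls (flip e x) = cls x" using cls_eq[OF e(2)] .
    ultimately show step: "(case p of (x, e) \<Rightarrow> (flip e x, e)) \<in> Sigma S inner"
      and "(case case p of (x, e) \<Rightarrow> (flip e x, e) of (x, e) \<Rightarrow> weight x * ?U x)
        = (case p of (x, e) \<Rightarrow> weight x * ?U (flip e x))"
      using x e self_in_cls[OF x] by (simp_all add: inner_def weight_def)
    show "(case p of (x, e) \<Rightarrow> (flip e x, e)) \<in> Sigma S inner" by (rule step)
  qed auto
  also have "\<dots> = (\<Sum>x\<in>S. \<Sum>e\<in>inner x. weight x * ?U x)"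
    by (rule sum.Sigma[symmetric]; simp add: finite_S)
  also have "\<dots> \<le> (\<Sum>x\<in>S. (1 - weight x) * ?U x)"
  proof (rule sum_mono)
    fix x assume x: "x \<in> S"
    have "real (card (inner x)) + 1 \<le> real (card (cls x))"
      using card_inner_less[OF x] card_cls_pos[OF x] by linarith
    then have "(real (card (inner x)) + 1) / real (card (cls x)) \<le> 1"
      by (simp add: divide_le_eq)
    then have "real (card (inner x)) * weight x \<le> 1 - weight x"
      using x by (simp add: weight_def add_divide_distrib)
    then have "real (card (inner x)) * weight x * ?U x \<le> (1 - weight x) * ?U x"
      by (rule mult_right_mono) simp
    then show "(\<Sum>e\<in>inner x. weight x * ?U x) \<le> (1 - weight x) * ?U x"
      by (simp add: mult.assoc)
  qed
  finally show ?thesis .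
qed

lemma sum_weight: "(\<Sum>x\<in>V. weight x) = real k"
proof -
  have "(\<Sum>x\<in>V. weight x) = (\<Sum>x\<in>S. weight x)"
    using S_subset weight_eq_0_iff by (intro sum.mono_neutral_right finite_cube) blast+
  also have "\<dots> = (\<Sum>x\<in>S. 1 / real (card {y \<in> S. f y = f x}))"
    by (rule sum.cong) (simp_all add: weight_def cls_def)
  also have "\<dots> = real (card (f ` S))"
    by (rule sum_inverse_card_fibres[OF finite_S])
  also have "f ` S = Some ` ran f"
    by (auto simp: ran_def image_iff) (metis domI)
  also have "card (Some ` ran f) = k"
    using coloring by (simp add: card_image sub_quorum_coloring_def)
  finally show ?thesis .
qed

lemma sum_square:
  fixes g :: "bool list \<Rightarrow> real"
  shows "(\<Sum>x\<in>V. g x + g (flip i x) + g (flip j x) + g (flip i (flip j x))) = 4 * (\<Sum>x\<in>V. g x)"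
proof -
  have one: "(\<Sum>x\<in>V. h (flip i x)) = (\<Sum>x\<in>V. h x)" for h :: "bool list \<Rightarrow> real" and i
    using sum.reindex_bij_betw[OF bij_betw_flip] .
  have "(\<Sum>x\<in>V. g (flip i (flip j x))) = (\<Sum>x\<in>V. g x)"
    using one[of "\<lambda>x. g (flip i x)" j] one[of g i] by simp
  then show ?thesis
    by (simp add: sum.distrib one[of g])
qed

text \<open>
  Every square is counted once for each of its corners and each order of its two directions, which
  multiplies both sides of the estimate by the same factor.
\<close>

lemma colors_le:
  assumes "n \<ge> 2"
  shows "k \<le> 2 ^ (n - 1)"
proof -
  let ?P = "{(i, j). i < n \<and> j < n \<and> i \<noteq> j}"
  let ?sq = "\<lambda>g x i j. g x + g (flip i x) + g (flip j x) + g (flip i (flip j x)) :: real"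
  have cardP: "card ?P = n * (n - 1)"
    using card_off_diagonal[of "{..<n}"] by simp
  have per_pair: "4 * real k - 2 * 2 ^ n \<le> 4 * (\<Sum>x\<in>V. charge x i j)" if "(i, j) \<in> ?P" for i j
  proof -
    have "4 * real k - 2 * 2 ^ n = (\<Sum>x\<in>V. ?sq weight x i j - 2)"
      by (simp add: sum_subtractf sum_square sum_weight card_cube)
    also have "\<dots> \<le> (\<Sum>x\<in>V. ?sq (\<lambda>x. charge x i j) x i j)"
      using that by (intro sum_mono square_bound) simp_all
    also have "\<dots> = 4 * (\<Sum>x\<in>V. charge x i j)"
      by (rule sum_square[of "\<lambda>x. charge x i j" i j])
    finally show ?thesis .
  qed
  have "real (n * (n - 1)) * (4 * real k - 2 * 2 ^ n) = (\<Sum>(i, j)\<in>?P. 4 * real k - 2 * 2 ^ n)"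
    by (simp add: cardP)
  also have "\<dots> \<le> (\<Sum>(i, j)\<in>?P. 4 * (\<Sum>x\<in>V. charge x i j))"
    by (rule sum_mono) (use per_pair in auto)
  also have "\<dots> = 4 * (\<Sum>x\<in>V. \<Sum>(i, j)\<in>?P. charge x i j)"
    by (simp add: case_prod_unfold sum_distrib_left[symmetric]) (rule sum.swap)
  also have "(\<Sum>x\<in>V. \<Sum>(i, j)\<in>?P. charge x i j) = (\<Sum>x\<in>S. \<Sum>(i, j)\<in>?P. charge x i j)"
    using S_subset by (intro sum.mono_neutral_right finite_cube) (auto simp: corner_charge_def weight_eq_0_iff)
  also have "\<dots> \<le> 0"
    using sum_lonely_le_sum_uncolored by (simp add: sum_charge_at sum_subtractf)
  finally have "real (n * (n - 1)) * (4 * real k - 2 * 2 ^ n) \<le> 0"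
    by simp
  moreover have "real (n * (n - 1)) > 0"
    using assms by simp
  ultimately have "4 * real k - 2 * 2 ^ n \<le> 0"
    by (metis linorder_not_le mult_pos_pos)
  then have "2 * real k \<le> 2 * 2 ^ (n - 1)"
    using assms by (cases n) simp_all
  then have "real k \<le> real (2 ^ (n - 1))" by simp
  then show ?thesis by (simp only: of_nat_le_iff)
qed

end

theorem theorem6p2:
  fixes n :: nat
  assumes "n \<ge> 2"
  shows "psi_sq (hypercube n) = beta_2 (hypercube n) \<and> beta_2 (hypercube n) = 2 ^ (n - 1)"
proof -
  have fin: "finite (pverts (hypercube n))"
    by (simp add: hypercube_def finite_cube)
  have "psi_sq (hypercube n) \<le> 2 ^ (n - 1)"
    unfolding psi_sq_def
  proof (rule Max.boundedI[OF finite_sub_quorum_sizes[OF fin] sub_quorum_sizes_nonempty])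
    fix k assume "k \<in> {k. \<exists>f. sub_quorum_coloring (hypercube n) k f}"
    then obtain f where "sub_quorum_coloring (hypercube n) k f" by blast
    then interpret colored_hypercube n k f by unfold_locales
    show "k \<le> 2 ^ (n - 1)" using colors_le[OF assms] .
  qed
  moreover have "2 ^ (n - 1) \<le> beta_2 (hypercube n)"
    unfolding beta_2_def
  proof (rule Max_ge)
    show "2 ^ (n - 1) \<in> card ` {S. two_independent (hypercube n) S}"
      using two_independent_even_weight[of n] card_even_weight[of n] assms
      by (intro image_eqI[where x = "{x. length x = n \<and> even (card {j. j < n \<and> x ! j})}"]) auto
  qed (simp add: finite_two_independent[OF fin])
  moreover have "beta_2 (hypercube n) \<le> psi_sq (hypercube n)"
    unfolding beta_2_def
    by (rule Max.boundedI)
      (use two_independent_empty card_le_psi_sq_if_two_independent[OF fin]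
        in \<open>auto simp: finite_two_independent[OF fin]\<close>)
  ultimately show ?thesis by linarith
qed

end
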